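(* Let $W=\mathsf{NEENEEN}$ (written $\mathsf{NE}^2\mathsf{NE}^2\mathsf{N}$), let $d$ be a positive even integer, and consider the directional CSS code of $W$ on the torus $\mathbb{Z}_{L_x}\times\mathbb{Z}_{L_y}$ with $(L_x,L_y)=(2d,d)$ and the row-alternating layout. Then its number of logical qubits is $$k=\begin{cases}4,& 6\mid d,\\ 0,& 6\nmid d.\end{cases}$$
   Context: Torus: for even positive integers $L_x,L_y$ let $G=\mathbb{Z}_{L_x}\times\mathbb{Z}_{L_y}$, with data sites $\Lambda_Q=\{(x,y)\in G: x+y \text{ even}\}$ and ancilla sites $\Lambda_A=\{(x,y)\in G: x+y\text{ odd}\}$, so $|\Lambda_Q|=|\Lambda_A|=n=\tfrac12L_xL_y$. Words: a direction word is a string $d_1\cdots d_w$ of steps from $\mathsf N=(0,1),\mathsf E=(1,0),\mathsf S=(0,-1),\mathsf W=(-1,0)$; its offsets are $Q_j=2\sum_{t<j}d_t+d_j$ and its support pattern is $P(W)=\{Q_1,\dots,Q_w\}\subset\mathbb{Z}^2$. For $W=\mathsf{NEENEEN}$ one has $P(W)=\{(0,1),(1,2),(3,2),(4,3),(5,4),(7,4),(8,5)\}$. Layout and checks: the row-alternating layout puts an ancilla $(x,y)$ in $\Lambda_X$ if $y$ is even and in $\Lambda_Z$ if $y$ is odd. $H_X$ (resp. $H_Z$) is the matrix over $\mathbb{F}_2$ with columns indexed by $\Lambda_Q$ and one row for each $a\in\Lambda_X$ (resp. $a\in\Lambda_Z$), that row being $\sum_{Q\in P(W)}e_{a+Q}\in\mathbb{F}_2^{\Lambda_Q}$,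 where $a+Q$ is reduced in $G$ (coinciding targets add modulo 2). The number of logical qubits is $k=n-\operatorname{rank}(H_X)-\operatorname{rank}(H_Z)$. *)

theory Defs
  imports Complex_Main "HOL-Library.Z2" "HOL-Library.Function_Algebras" "HOL-Library.Product_Plus"
begin

definition fun_scale :: "'a::field \<Rightarrow> ('c \<Rightarrow> 'a) \<Rightarrow> 'c \<Rightarrow> 'a" where
  "fun_scale c v = (\<lambda>q. c * v q)"

lemma vector_space_fun_scale: "vector_space fun_scale"
  by unfold_locales (auto simp: fun_scale_def plus_fun_def fun_eq_iff algebra_simps)

text \<open>
  A matrix with row index set \<open>R\<close> and column index set \<open>C\<close> is a function \<open>M\<close> of which only
  the entries \<open>M r c\<close> with \<open>r \<in> R\<close>, \<open>c \<in> C\<close> matter. Its rank is the dimension of the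
  row space; \<open>F\<^sup>C\<close> is embedded into \<open>'c \<Rightarrow> F\<close> by extending vectors by zero outside \<open>C\<close>.
\<close>

definition matrix_rank :: "'r set \<Rightarrow> 'c set \<Rightarrow> ('r \<Rightarrow> 'c \<Rightarrow> 'a::field) \<Rightarrow> nat" where
  "matrix_rank R C M =
     vector_space.dim fun_scale ((\<lambda>r c. if c \<in> C then M r c else 0) ` R)"

datatype direction = North | East | South | West

fun step :: "direction \<Rightarrow> int \<times> int" where
  "step North = (0, 1)"
| "step East = (1, 0)"
| "step South = (0, -1)"
| "step West = (-1, 0)"

text \<open>Positions in a word are counted from 0.\<close>

definition offset :: "direction list \<Rightarrow> nat \<Rightarrow> int \<times> int" where
  "offset w j = (let s = (\<Sum>t<j. step (w ! t)) in s + s + step (w ! j))"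

definition support_pattern :: "direction list \<Rightarrow> (int \<times> int) set" where
  "support_pattern w = offset w ` {..<length w}"

lemma support_pattern_NEENEEN:
  "support_pattern [North, East, East, North, East, East, North] =
     {(0,1), (1,2), (3,2), (4,3), (5,4), (7,4), (8,5)}"
  by (simp add: support_pattern_def offset_def Let_def lessThan_Suc lessThan_nat_numeral
      zero_prod_def insert_commute)

text \<open>
  Elements of \<open>\<int>\<^bsub>Lx\<^esub> \<times> \<int>\<^bsub>Ly\<^esub>\<close> are represented by their least
  nonnegative residues. The parities below describe residue classes only when \<open>Lx\<close>
  and \<open>Ly\<close> are even, which is the intended range of these definitions.
\<close>

definition torus :: "nat \<Rightarrow> nat \<Rightarrow> (int \<times> int) set" where
  "torus Lx Ly = {0..<int Lx} \<times> {0..<int Ly}"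

definition torus_reduce :: "nat \<Rightarrow> nat \<Rightarrow> int \<times> int \<Rightarrow> int \<times> int" where
  "torus_reduce Lx Ly p = (fst p mod int Lx, snd p mod int Ly)"

definition data_sites :: "nat \<Rightarrow> nat \<Rightarrow> (int \<times> int) set" where
  "data_sites Lx Ly = {(x, y) \<in> torus Lx Ly. even (x + y)}"

definition ancilla_sites :: "nat \<Rightarrow> nat \<Rightarrow> (int \<times> int) set" where
  "ancilla_sites Lx Ly = {(x, y) \<in> torus Lx Ly. odd (x + y)}"

text \<open>The X and Z ancillas of the row-alternating layout.\<close>

definition X_sites :: "nat \<Rightarrow> nat \<Rightarrow> (int \<times> int) set" where
  "X_sites Lx Ly = {(x, y) \<in> ancilla_sites Lx Ly. even y}"

definition Z_sites :: "nat \<Rightarrow> nat \<Rightarrow> (int \<times> int) set" where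
  "Z_sites Lx Ly = {(x, y) \<in> ancilla_sites Lx Ly. odd y}"

text \<open>
  The sum is taken in the two-element field \<open>bit\<close>, so that targets coinciding on the torus cancel in pairs.
\<close>

definition check_entry ::
    "direction list \<Rightarrow> nat \<Rightarrow> nat \<Rightarrow> int \<times> int \<Rightarrow> int \<times> int \<Rightarrow> bit" where
  "check_entry w Lx Ly a q =
     (\<Sum>Q\<in>support_pattern w. if torus_reduce Lx Ly (a + Q) = q then 1 else 0)"

definition rank_HX :: "direction list \<Rightarrow> nat \<Rightarrow> nat \<Rightarrow> nat" where
  "rank_HX w Lx Ly = matrix_rank (X_sites Lx Ly) (data_sites Lx Ly) (check_entry w Lx Ly)"

definition rank_HZ :: "direction list \<Rightarrow> nat \<Rightarrow> nat \<Rightarrow> nat" where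
  "rank_HZ w Lx Ly = matrix_rank (Z_sites Lx Ly) (data_sites Lx Ly) (check_entry w Lx Ly)"

text \<open>Integer-valued, since subtraction on the natural numbers truncates at 0.\<close>

definition logical_qubits :: "direction list \<Rightarrow> nat \<Rightarrow> nat \<Rightarrow> int" where
  "logical_qubits w Lx Ly =
     int (card (data_sites Lx Ly)) - int (rank_HX w Lx Ly) - int (rank_HZ w Lx Ly)"

end

theory Submission
  imports Defs
begin

text \<open>
  The number of logical qubits is the number of linear relations among the X checks plus the number
  among the Z checks. On one class of ancillas, put \<open>u = x\<^sup>2\<close> and \<open>m = x\<^sup>4 y\<^sup>2\<close>; sorting the
  targets by the parity of their second coordinate, a relation is a function on the class annihilated
  by \<open>1 + m + m\<^sup>2\<close> and by \<open>(1 + u)(1 + m)\<close>. The first equation makes \<open>1 + m\<close> invertible, so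
  \<open>u\<close> acts trivially and \<open>m\<close> acts as \<open>v = y\<^sup>2\<close>. A relation therefore depends on \<open>y\<close> only and satisfies
  \<open>1 + v + v\<^sup>2 = 0\<close>, hence has period 6 in \<open>y\<close>. As it also has period \<open>d\<close>, the relations form a space
  of dimension 2 if \<open>6\<close> divides \<open>d\<close> and of dimension 0 otherwise.
\<close>

section \<open>Rank as the size of an independent spanning set of rows\<close>

lemma sum_fun_apply: "(\<Sum>i\<in>A. (f i :: 'b \<Rightarrow> 'c::comm_monoid_add)) x = (\<Sum>i\<in>A. f i x)"
  by (induction A rule: infinite_finite_induct) auto

text \<open>\<open>indep\<close> makes the rows over \<open>B\<close> independent. For each other
  row, \<open>rel\<close> supplies a relation with coefficient 1 there and 0 at the remaining rows
  outside \<open>B\<close>; solving it puts that row in the span of the rows over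
  \<open>B\<close>.\<close>

lemma matrix_rank_eq_card:
  fixes M :: "'r \<Rightarrow> 'c \<Rightarrow> 'a::field"
  assumes "finite R" "B \<subseteq> R"
    and indep: "\<And>f r. (\<And>r. r \<notin> B \<Longrightarrow> f r = 0) \<Longrightarrow>
        (\<And>c. c \<in> C \<Longrightarrow> (\<Sum>r\<in>R. f r * M r c) = 0) \<Longrightarrow> f r = 0"
    and rel: "\<And>r. r \<in> R - B \<Longrightarrow> \<exists>g. g r = 1 \<and> (\<forall>r'\<in>R - B - {r}. g r' = 0) \<and>
        (\<forall>c\<in>C. (\<Sum>r'\<in>R. g r' * M r' c) = 0)"
  shows "matrix_rank R C M = card B"
proof -
  interpret vector_space "fun_scale :: 'a \<Rightarrow> ('c \<Rightarrow> 'a) \<Rightarrow> 'c \<Rightarrow> 'a"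
    by (rule vector_space_fun_scale)
  define row where "row = (\<lambda>r c. if c \<in> C then M r c else 0)"
  have finB: "finite B" using assms finite_subset by blast
  have combination: "(\<Sum>r\<in>R. f r * M r c) = (\<Sum>r\<in>B. f r * M r c)"
    if "\<And>r. r \<in> R - B \<Longrightarrow> f r = 0" for f c
    using that by (intro sum.mono_neutral_right) (auto simp: assms)
  have inj: "inj_on row B"
  proof (rule inj_onI, rule ccontr)
    fix r s assume rs: "r \<in> B" "s \<in> B" "row r = row s" "r \<noteq> s"
    \<comment> \<open>Equal rows at distinct indices would make this difference of indicators a
      relation, so \<open>card B\<close> also counts the rows themselves.\<close>
    define f where "f = (\<lambda>t. (if t = r then 1 else 0) - (if t = s then 1 else (0::'a)))"
    have "f r = 0"
    proof (rule indep)
      show "f t = 0" if "t \<notin> B" for t using that rs by (auto simp: f_def)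
      fix c assume c: "c \<in> C"
      then have eq: "M r c = M s c" using rs(3) unfolding row_def by (metis (no_types, lifting))
      have "(\<Sum>t\<in>R. f t * M t c)
          = (\<Sum>t\<in>R. if t = r then M t c else 0) - (\<Sum>t\<in>R. if t = s then M t c else 0)"
        unfolding sum_subtractf[symmetric] by (intro sum.cong) (auto simp: f_def)
      also have "\<dots> = 0"
        using rs assms eq by (auto simp: sum.delta)
      finally show "(\<Sum>t\<in>R. f t * M t c) = 0" .
    qed
    then show False using rs by (simp add: f_def)
  qed
  have "independent (row ` B)"
  proof (rule independent_if_scalars_zero)
    show "finite (row ` B)" using finB by simp
    fix u v assume u: "(\<Sum>v\<in>row ` B. fun_scale (u v) v) = 0" and "v \<in> row ` B"
    then obtain b where b: "b \<in> B" "v = row b" by blast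
    define f where "f = (\<lambda>r. if r \<in> B then u (row r) else 0)"
    have "f b = 0"
    proof (rule indep)
      show "f t = 0" if "t \<notin> B" for t using that by (auto simp: f_def)
      fix c assume c: "c \<in> C"
      have "(\<Sum>t\<in>R. f t * M t c) = (\<Sum>t\<in>B. f t * M t c)"
        by (rule combination) (simp add: f_def)
      also have "\<dots> = (\<Sum>t\<in>B. fun_scale (u (row t)) (row t)) c"
        unfolding sum_fun_apply using c by (intro sum.cong) (auto simp: f_def fun_scale_def row_def)
      also have "\<dots> = 0"
        using u by (simp add: sum.reindex[OF inj])
      finally show "(\<Sum>t\<in>R. f t * M t c) = 0" .
    qed
    then show "u v = 0" using b by (simp add: f_def)
  qed
  moreover have "row ` R \<subseteq> span (row ` B)"
  proof
    fix v assume "v \<in> row ` R"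
    then obtain r where r: "r \<in> R" "v = row r" by blast
    show "v \<in> span (row ` B)"
    proof (cases "r \<in> B")
      case True
      then show ?thesis using r by (auto intro: span_base)
    next
      case False
      then obtain g where g: "g r = 1" "\<And>r'. r' \<in> R - B - {r} \<Longrightarrow> g r' = 0"
        "\<And>c. c \<in> C \<Longrightarrow> (\<Sum>r'\<in>R. g r' * M r' c) = 0"
        using rel[of r] r by blast
      have "v = (\<Sum>t\<in>B. fun_scale (- g t) (row t))"
      proof
        fix c
        have "(\<Sum>t\<in>R. g t * M t c) = M r c + (\<Sum>t\<in>R - {r}. g t * M t c)"
          using r g(1) assms by (simp add: sum.remove)
        also have "(\<Sum>t\<in>R - {r}. g t * M t c) = (\<Sum>t\<in>B. g t * M t c)"
          using False assms g(2) by (intro sum.mono_neutral_right) auto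
        finally have "c \<in> C \<Longrightarrow> M r c = - (\<Sum>t\<in>B. g t * M t c)"
          using g(3)[of c] by (simp add: eq_neg_iff_add_eq_0)
        then show "v c = (\<Sum>t\<in>B. fun_scale (- g t) (row t)) c"
          unfolding sum_fun_apply
          by (simp add: r row_def fun_scale_def sum_negf)
      qed
      then show ?thesis
        by (simp only:) (intro span_sum span_scale span_base imageI)
    qed
  qed
  moreover have "row ` B \<subseteq> row ` R" using assms by blast
  ultimately show ?thesis
    unfolding matrix_rank_def row_def[symmetric]
    by (intro dim_unique[of "row ` B"]) (auto simp: card_image inj)
qed

section \<open>Relations among checks as convolution equations on the torus\<close>

lemma finite_torus: "finite (torus Lx Ly)"
  by (simp add: torus_def)

lemma torus_reduce_eq_iff:
  assumes "r \<in> torus Lx Ly" "q \<in> torus Lx Ly"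
  shows "torus_reduce Lx Ly (r + Q) = q \<longleftrightarrow> r = torus_reduce Lx Ly (q - Q)"
proof -
  have *: "(a + b) mod n = c \<longleftrightarrow> a = (c - b) mod n"
    if "0 \<le> a" "a < n" "0 \<le> c" "c < n" for a b c n :: int
    using that by (metis add_diff_cancel_right' diff_add_cancel mod_add_left_eq mod_diff_left_eq mod_pos_pos_trivial)
  show ?thesis
    using assms by (auto simp: torus_def torus_reduce_def * prod_eq_iff)
qed

text \<open>Exchanging the sums turns the entry at \<open>q\<close> into a sum over the sites
  \<open>q - Q\<close>; extending \<open>f\<close> by zero absorbs those outside
  \<open>R\<close>.\<close>

lemma check_combination:
  assumes "\<And>r. r \<notin> R \<Longrightarrow> f r = 0" "R \<subseteq> torus Lx Ly" "q \<in> torus Lx Ly"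
  shows "(\<Sum>r\<in>R. f r * check_entry w Lx Ly r q) =
    (\<Sum>Q\<in>support_pattern w. f (torus_reduce Lx Ly (q - Q)))"
proof -
  have fin: "finite R" using assms(2) finite_torus finite_subset by blast
  have "(\<Sum>r\<in>R. f r * check_entry w Lx Ly r q) =
    (\<Sum>Q\<in>support_pattern w. \<Sum>r\<in>R. if r = torus_reduce Lx Ly (q - Q) then f r else 0)"
    unfolding check_entry_def sum_distrib_left
    using assms(2,3) by (subst sum.swap, intro sum.cong refl)
      (simp add: torus_reduce_eq_iff subset_iff del: split_paired_All)
  also have "\<dots> = (\<Sum>Q\<in>support_pattern w. f (torus_reduce Lx Ly (q - Q)))"
    using assms(1) fin by (intro sum.cong) (auto simp: sum.delta)
  finally show ?thesis .
qed


section \<open>Relations lifted to the integer plane\<close>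

context
  fixes F :: "int \<Rightarrow> int \<Rightarrow> bit" and e :: bool
  assumes off_class: "\<And>x y. even (x + y) \<or> even y \<noteq> e \<Longrightarrow> F x y = 0"
    and checks: "\<And>x y. even (x + y) \<Longrightarrow>
      F x (y - 1) + F (x - 1) (y - 2) + F (x - 3) (y - 2) + F (x - 4) (y - 3) +
      F (x - 5) (y - 4) + F (x - 7) (y - 4) + F (x - 8) (y - 5) = 0"
begin

text \<open>In the equation at the data site \<open>(x, y + 1)\<close>, offsets with even second
  coordinate lead to rows of the wrong parity; the other three give
  \<open>1 + m + m^2\<close>.\<close>

lemma kernel_trinomial: "F x y + F (x - 4) (y - 2) + F (x - 8) (y - 4) = 0"
proof (cases "odd (x + y) \<and> even y = e")
  case True
  then show ?thesis
    using checks[of x "y + 1"] by (simp add: off_class)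
qed (auto simp: off_class)

text \<open>At the data site \<open>(x + 1, y + 2)\<close> the offsets with odd second coordinate
  drop out instead; the other four give \<open>1 + u + m + u * m\<close>.\<close>

lemma kernel_factored:
  "F x y + F (x - 2) y + F (x - 4) (y - 2) + F (x - 6) (y - 2) = 0"
proof (cases "odd (x + y) \<and> even y = e")
  case True
  then show ?thesis
    using checks[of "x + 1" "y + 2"] by (simp add: off_class)
qed (auto simp: off_class)

text \<open>\<open>(1 + u)(1 + m + m^2) - (1 + u)(1 + m) = (1 + u) m^2\<close>, and
  \<open>m^2\<close> is an invertible translation, undone by evaluating at
  \<open>(x + 8, y + 4)\<close>.\<close>

lemma kernel_shift_x: "F (x - 2) y = F x y"
proof -
  have "F (x + 8) (y + 4) + F (x + 4) (y + 2) + F x y = 0"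
    using kernel_trinomial[of "x + 8" "y + 4"] by (simp add: add.commute)
  moreover have "F (x + 6) (y + 4) + F (x + 2) (y + 2) + F (x - 2) y = 0"
    using kernel_trinomial[of "x + 6" "y + 4"] by (simp add: add.commute)
  moreover have "F (x + 8) (y + 4) + F (x + 6) (y + 4) + F (x + 4) (y + 2) + F (x + 2) (y + 2) = 0"
    using kernel_factored[of "x + 8" "y + 4"] by (simp add: add.commute)
  ultimately show ?thesis
    by (cases "F (x + 8) (y + 4)"; cases "F (x + 6) (y + 4)";
        cases "F (x + 4) (y + 2)"; cases "F (x + 2) (y + 2)") simp_all
qed

lemma kernel_even_shift_x: "even (x - x') \<Longrightarrow> F x y = F x' y"
proof -
  have *: "F (z - 2 * int n) y = F z y" for z n
  proof (induction n)
    case (Suc n)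
    then show ?case using kernel_shift_x[of "z - 2 * int n" y] by (simp add: algebra_simps)
  qed simp
  assume "even (x - x')"
  then obtain k where k: "x = x' + 2 * k" by (metis add_diff_cancel_left' diff_add_cancel evenE add.commute)
  show ?thesis
    using *[of x' "nat (- k)"] *[of x "nat k"] k by (cases "k \<ge> 0") auto
qed

lemma kernel_three_term: "F x y + F x (y - 2) + F x (y - 4) = 0"
  using kernel_trinomial[of x y] kernel_even_shift_x[of x "x - 4" "y - 2"]
    kernel_even_shift_x[of x "x - 8" "y - 4"] by simp

text \<open>Over the two-element field \<open>(1 + v)(1 + v + v^2) = 1 + v^3\<close>, and
  \<open>v^3\<close> is the shift by six rows.\<close>

lemma kernel_shift_y: "F x (y - 6) = F x y"
  using kernel_three_term[of x y] kernel_three_term[of x "y - 2"]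
  by (cases "F x y"; cases "F x (y - 2)") auto

lemma kernel_mod_6: "F x y = F x (y mod 6)"
proof -
  have *: "F x (z - 6 * int n) = F x z" for z n
  proof (induction n)
    case (Suc n)
    then show ?case using kernel_shift_y[of x "z - 6 * int n"] by (simp add: algebra_simps)
  qed simp
  have "y mod 6 = y - 6 * (y div 6)" by (simp add: minus_div_mult_eq_mod[symmetric])
  then show ?thesis
    using *[of y "nat (y div 6)"] *[of "y mod 6" "nat (- (y div 6))"]
    by (cases "y div 6 \<ge> 0") auto
qed

text \<open>Such a period has gcd 2 with the period 6, so \<open>F\<close> is 2-periodic in
  \<open>y\<close> and the three-term relation reads \<open>3 F = F = 0\<close>.\<close>

lemma kernel_trivial_if_period:
  assumes period: "\<And>x y. F x (y - p) = F x y" and "even p" "\<not> 6 dvd p"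
  shows "F x y = 0"
proof -
  have "F x (y - p) = F x (y - p mod 6)" for y
    by (subst (1 2) kernel_mod_6) (simp add: mod_simps)
  then have *: "F x (y - p mod 6) = F x y" for y
    using period by simp
  have "p mod 6 = 2 \<or> p mod 6 = 4"
    using assms(2,3) by presburger
  then show ?thesis
  proof
    assume "p mod 6 = 2"
    then show ?thesis
      using *[of y] *[of "y - 2"] kernel_three_term[of x y] by simp
  next
    \<comment> \<open>Here the outer terms, two rows above and below \<open>y\<close>, agree and
      cancel, leaving \<open>F x y\<close>.\<close>
    assume "p mod 6 = 4"
    then show ?thesis
      using *[of "y + 2"] *[of y] kernel_three_term[of x "y + 2"]
      by (cases "F x y"; cases "F x (y + 2)") auto
  qed
qed

text \<open>A relation is determined by its values at two consecutive rows of the class, so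
  deleting two checks leaves an independent family.\<close>

lemma kernel_trivial_if_zeros:
  assumes "F (1 - p) p = 0" "F (1 - p) (p + 2) = 0" "p = (if e then 0 else 1)"
  shows "F x y = 0"
proof (cases "odd (x + y) \<and> even y = e")
  case True
  \<comment> \<open>The class fixes the parity of \<open>x\<close>, and \<open>1 - p\<close> is a
    column of that parity.\<close>
  then have "even (x - (1 - p))" using assms(3) by (auto split: if_splits)
  then have "F x y = F (1 - p) (y mod 6)"
    using kernel_even_shift_x kernel_mod_6 by metis
  moreover have "y mod 6 \<in> {p, p + 2, p + 4}"
    using True assms(3) by (cases e) (simp_all, presburger+)
  moreover have "F (1 - p) (p + 4) = 0"
    using kernel_three_term[of "1 - p" "p + 4"] assms by (cases e) auto
  ultimately show ?thesis using assms by auto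
qed (auto simp: off_class)

end


section \<open>Rank of one class of checks (\<open>e\<close> true for X, false for Z)\<close>

definition check_class :: "bool \<Rightarrow> nat \<Rightarrow> (int \<times> int) set" where
  "check_class e d = {(x, y) \<in> torus (2 * d) d. odd (x + y) \<and> even y = e}"

lemma torus_reduce_in_torus: "d > 0 \<Longrightarrow> torus_reduce (2 * d) d z \<in> torus (2 * d) d"
  by (cases z) (simp add: torus_def torus_reduce_def)

lemma even_mod_iff: "even n \<Longrightarrow> even (a mod n) \<longleftrightarrow> even a" for a n :: int
  by (simp add: dvd_mod_iff)

lemma torus_reduce_diff_torus_reduce:
  "torus_reduce Lx Ly (torus_reduce Lx Ly z - Q) = torus_reduce Lx Ly (z - Q)"
  by (simp add: torus_reduce_def mod_simps)

abbreviation "NEENEEN \<equiv> [North, East, East, North, East, East, North]"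

lemma sum_support_pattern_NEENEEN:
  "(\<Sum>Q\<in>support_pattern NEENEEN. g ((x, y) - Q)) =
    g (x, y - 1) + g (x - 1, y - 2) + g (x - 3, y - 2) + g (x - 4, y - 3) +
    g (x - 5, y - 4) + g (x - 7, y - 4) + g (x - 8, y - 5)"
  for g :: "int \<times> int \<Rightarrow> 'a::comm_monoid_add"
  unfolding support_pattern_NEENEEN by (simp add: add.assoc)

text \<open>The deficiency is the dimension of the relation space. A relation vanishing on the set
  \<open>Z\<close> below is zero, so the checks outside \<open>Z\<close> are independent; each unit
  vector on \<open>Z\<close> extends to a relation, so each check in \<open>Z\<close> is a sum of
  checks outside it.\<close>

lemma rank_check_class:
  assumes "d > 0" "even d"
  shows "int (matrix_rank (check_class e d) (data_sites (2 * d) d) (check_entry NEENEEN (2 * d) d)) =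
    int (card (check_class e d)) - (if 6 dvd d then 2 else 0)"
proof -
  define R where "R = check_class e d"
  define p :: int where "p = (if e then 0 else 1)"
  define Z where "Z = (if 6 dvd d then {(1 - p, p), (1 - p, p + 2)} else {})"
  have R_torus: "R \<subseteq> torus (2 * d) d" by (auto simp: R_def check_class_def)
  then have finR: "finite R" using finite_torus finite_subset by blast
  \<comment> \<open>This keeps row \<open>p + 2\<close>, which is at most 3, inside the
    torus.\<close>
  have "int d \<ge> 6" if "6 dvd d" using that assms(1) by (auto dest: dvd_imp_le)
  then have ZR: "Z \<subseteq> R"
    by (auto simp: Z_def R_def check_class_def torus_def p_def)
  have "matrix_rank R (data_sites (2 * d) d) (check_entry NEENEEN (2 * d) d) = card (R - Z)"
  proof (rule matrix_rank_eq_card)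
    show "finite R" "R - Z \<subseteq> R" using finR by auto
  next
    fix f :: "int \<times> int \<Rightarrow> bit" and r
    assume supp: "\<And>r. r \<notin> R - Z \<Longrightarrow> f r = 0"
      and ker: "\<And>q. q \<in> data_sites (2 * d) d \<Longrightarrow>
        (\<Sum>r\<in>R. f r * check_entry NEENEEN (2 * d) d r q) = 0"
    \<comment> \<open>The doubly periodic lift of \<open>f\<close> lets translations act without
      wraparound.\<close>
    define F where "F = (\<lambda>x y. f (torus_reduce (2 * d) d (x, y)))"
    have F_off: "F x y = 0" if "even (x + y) \<or> even y \<noteq> e" for x y
    proof -
      have "torus_reduce (2 * d) d (x, y) \<notin> R"
        using that assms by (auto simp: R_def check_class_def torus_reduce_def even_mod_iff)
      then show ?thesis by (simp add: F_def supp)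
    qed
    have F_checks: "F x (y - 1) + F (x - 1) (y - 2) + F (x - 3) (y - 2) + F (x - 4) (y - 3) +
      F (x - 5) (y - 4) + F (x - 7) (y - 4) + F (x - 8) (y - 5) = 0" if "even (x + y)" for x y
    proof -
      define q where "q = torus_reduce (2 * d) d (x, y)"
      have q: "q \<in> torus (2 * d) d" using assms by (simp add: q_def torus_reduce_in_torus)
      then have "q \<in> data_sites (2 * d) d"
        using that assms by (auto simp: data_sites_def q_def torus_reduce_def even_mod_iff)
      then have "(\<Sum>Q\<in>support_pattern NEENEEN. f (torus_reduce (2 * d) d (q - Q))) = 0"
        using ker check_combination[of R f "2 * d" d q NEENEEN] supp R_torus q by simp
      then have "(\<Sum>Q\<in>support_pattern NEENEEN. f (torus_reduce (2 * d) d ((x, y) - Q))) = 0"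
        unfolding q_def torus_reduce_diff_torus_reduce .
      then show ?thesis
        unfolding F_def sum_support_pattern_NEENEEN[of "\<lambda>z. f (torus_reduce (2 * d) d z)"] .
    qed
    have "F x y = 0" for x y
    proof (cases "6 dvd d")
      case True
      have "z \<in> Z \<Longrightarrow> torus_reduce (2 * d) d z = z" for z
        using ZR R_torus by (auto simp: torus_def torus_reduce_def)
      then have "F x' y' = 0" if "(x', y') \<in> Z" for x' y'
        using that by (simp add: F_def supp)
      then have "F (1 - p) p = 0" "F (1 - p) (p + 2) = 0"
        using True by (simp_all add: Z_def)
      from kernel_trivial_if_zeros[OF F_off F_checks this p_def] show ?thesis .
    next
      case False
      have period: "F x (y - int d) = F x y" for x y
        by (simp add: F_def torus_reduce_def)
      have "even (int d)" "\<not> 6 dvd int d"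
        using assms False by presburger+
      from kernel_trivial_if_period[OF F_off F_checks period this] show ?thesis .
    qed
    then have "F (fst r) (snd r) = 0" .
    then show "f r = 0"
      using supp[of r] R_torus
      by (cases "r \<in> R") (auto simp: F_def torus_reduce_def torus_def)
  next
    fix r assume "r \<in> R - (R - Z)"
    then have r: "r \<in> Z" by blast
    then have d6: "6 dvd d" by (auto simp: Z_def split: if_splits)
    define c where "c = (if snd r = p then p + 2 else p)"
    \<comment> \<open>The relation supported on two of the three row residues modulo 6; it avoids the other site of \<open>Z\<close>.\<close>
    define g :: "int \<times> int \<Rightarrow> bit"
      where "g = (\<lambda>z. if z \<in> R \<and> snd z mod 6 \<noteq> c then 1 else 0)"
    define G :: "int \<Rightarrow> int \<Rightarrow> bit"
      where "G = (\<lambda>x y. if odd (x + y) \<and> even y = e \<and> y mod 6 \<noteq> c then 1 else 0)"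
    have gG: "g (torus_reduce (2 * d) d z) = G (fst z) (snd z)" for z
    proof -
      \<comment> \<open>Row residues modulo 6 survive reduction modulo \<open>d\<close>, so
        \<open>G\<close> is the periodic lift of \<open>g\<close>.\<close>
      have "6 dvd int d" using d6 by presburger
      then have "(snd z mod int d) mod 6 = snd z mod 6"
        by (rule mod_mod_cancel)
      then show ?thesis
        using assms torus_reduce_in_torus[of d z]
        by (auto simp: g_def G_def R_def check_class_def torus_reduce_def even_mod_iff)
    qed
    have G_checks: "G x (y - 1) + G (x - 1) (y - 2) + G (x - 3) (y - 2) + G (x - 4) (y - 3) +
      G (x - 5) (y - 4) + G (x - 7) (y - 4) + G (x - 8) (y - 5) = 0" for x y
    proof -
      have c: "even c = e" "0 \<le> c" "c < 6" by (auto simp: c_def p_def)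
      \<comment> \<open>Exactly one of three consecutive rows of the class has residue
        \<open>c\<close>, so at \<open>even (x + y)\<close> two terms equal to 1 cancel. For the
        other parity of \<open>y\<close> the terms cancel in pairs, since \<open>G\<close> depends
        on \<open>x\<close> only through its parity.\<close>
      have "(y - 1) mod 6 = c \<and> (y - 3) mod 6 \<noteq> c \<and> (y - 5) mod 6 \<noteq> c \<or>
            (y - 1) mod 6 \<noteq> c \<and> (y - 3) mod 6 = c \<and> (y - 5) mod 6 \<noteq> c \<or>
            (y - 1) mod 6 \<noteq> c \<and> (y - 3) mod 6 \<noteq> c \<and> (y - 5) mod 6 = c" if "odd y = e"
      proof -
        define t where "t = (y - 5) mod 6"
        have "(y - 3) mod 6 = (t + 2) mod 6" "(y - 1) mod 6 = (t + 4) mod 6"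
          unfolding t_def by (simp_all add: mod_simps)
        moreover have "even t = e"
          using that unfolding t_def by (auto simp: even_mod_iff)
        then have "even (t - c)" using c(1) by auto
        moreover have "t \<in> {0, 1, 2, 3, 4, 5}" "c \<in> {0, 1, 2, 3, 4, 5}"
          using c pos_mod_bound[of 6 "y - 5"] pos_mod_sign[of 6 "y - 5"] unfolding t_def by auto
        ultimately show ?thesis unfolding t_def[symmetric] by (elim insertE emptyE) simp_all
      qed
      then show ?thesis
        by (cases "odd y = e"; cases "even (x + y)") (simp_all add: G_def, elim disjE, simp_all)
    qed
    show "\<exists>g. g r = 1 \<and> (\<forall>r'\<in>R - (R - Z) - {r}. g r' = 0) \<and>
        (\<forall>q\<in>data_sites (2 * d) d. (\<Sum>r'\<in>R. g r' * check_entry NEENEEN (2 * d) d r' q) = 0)"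
    proof (intro exI[of _ g] conjI ballI)
      show "g r = 1" using r ZR by (auto simp: g_def Z_def c_def p_def split: if_splits)
      show "g r' = 0" if "r' \<in> R - (R - Z) - {r}" for r'
        using r that by (auto simp: g_def Z_def c_def p_def split: if_splits)
      fix q assume "q \<in> data_sites (2 * d) d"
      then have "q \<in> torus (2 * d) d" by (auto simp: data_sites_def)
      then have "(\<Sum>r'\<in>R. g r' * check_entry NEENEEN (2 * d) d r' q) =
          (\<Sum>Q\<in>support_pattern NEENEEN. g (torus_reduce (2 * d) d ((fst q, snd q) - Q)))"
        using check_combination[of R g "2 * d" d q NEENEEN] R_torus by (simp add: g_def)
      also have "\<dots> = 0"
        using G_checks[of "fst q" "snd q"]
        unfolding sum_support_pattern_NEENEEN[of "\<lambda>z. g (torus_reduce (2 * d) d z)"]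
        by (simp only: gG fst_conv snd_conv)
      finally show "(\<Sum>r'\<in>R. g r' * check_entry NEENEEN (2 * d) d r' q) = 0" .
    qed
  qed
  moreover have "card Z = (if 6 dvd d then 2 else 0)" by (simp add: Z_def)
  moreover have "card (R - Z) + card Z = card R"
    using ZR finR by (metis card_Diff_subset card_mono finite_subset le_add_diff_inverse2)
  ultimately show ?thesis by (auto simp flip: R_def)
qed

section \<open>Counting data sites and ancillas\<close>

lemma card_even_below: "card {x \<in> {0..<int (2 * m)}. even x} = m"
proof -
  have "{x \<in> {0..<int (2 * m)}. even x} = (\<lambda>k. 2 * int k) ` {..<m}"
  proof safe
    fix x :: int assume "x \<in> {0..<int (2 * m)}" "even x"
    then show "x \<in> (\<lambda>k. 2 * int k) ` {..<m}"
      by (intro image_eqI[of _ _ "nat (x div 2)"]) auto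
  qed auto
  then show ?thesis by (simp add: card_image inj_on_def)
qed

lemma card_odd_below: "card {x \<in> {0..<int (2 * m)}. odd x} = m"
proof -
  have "{x \<in> {0..<int (2 * m)}. odd x} = (\<lambda>k. 2 * int k + 1) ` {..<m}"
  proof safe
    fix x :: int assume "x \<in> {0..<int (2 * m)}" "odd x"
    then show "x \<in> (\<lambda>k. 2 * int k + 1) ` {..<m}"
      by (intro image_eqI[of _ _ "nat (x div 2)"]) auto
  qed auto
  then show ?thesis by (simp add: card_image inj_on_def)
qed

text \<open>By this count \<open>n\<close> cancels against the numbers of checks, leaving the two
  rank deficiencies as \<open>k\<close>.\<close>

lemma card_check_classes:
  assumes "even d"
  shows "card (data_sites (2 * d) d) = card (check_class True d) + card (check_class False d)"
proof -
  obtain m where d: "d = 2 * m" using assms by blast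
  \<comment> \<open>The argument is half a side length: \<open>d\<close> for the
    \<open>2 * d\<close> columns, \<open>m\<close> for the \<open>d = 2 * m\<close> rows.\<close>
  let ?E = "\<lambda>n. {x \<in> {0..<int (2 * n)}. even x}" and ?O = "\<lambda>n. {x \<in> {0..<int (2 * n)}. odd x}"
  have fin: "finite {x \<in> {0..<n}. P x}" for n :: int and P
    by (rule finite_subset[of _ "{0..<n}"]) auto
  have data: "data_sites (2 * d) d = ?E d \<times> ?E m \<union> ?O d \<times> ?O m"
    by (auto simp: data_sites_def torus_def d)
  have "check_class True d = ?O d \<times> ?E m" "check_class False d = ?E d \<times> ?O m"
    by (auto simp: check_class_def torus_def d)
  moreover have "card (data_sites (2 * d) d) = card (?E d \<times> ?E m) + card (?O d \<times> ?O m)"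
    unfolding data by (intro card_Un_disjoint finite_cartesian_product fin) auto
  ultimately show ?thesis
    by (simp only: card_cartesian_product card_even_below card_odd_below)
qed

theorem theorem4:
  fixes d :: nat
  assumes "d > 0" and "even d"
  shows "logical_qubits [North, East, East, North, East, East, North] (2 * d) d =
           (if 6 dvd d then 4 else 0)"
proof -
  have "X_sites (2 * d) d = check_class True d" "Z_sites (2 * d) d = check_class False d"
    by (auto simp: X_sites_def Z_sites_def ancilla_sites_def check_class_def)
  then show ?thesis
    using rank_check_class[OF assms, of True] rank_check_class[OF assms, of False]
      card_check_classes[OF assms(2)]
    by (simp add: logical_qubits_def rank_HX_def rank_HZ_def)
qed

end
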